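(* Let $r$ and $t$ be positive integers. There is no distance-regular graph with intersection array $$\{(2r+1)(4r+1)(4t-1),\ 8r(4rt-r+2t),\ (r+t)(4r+1);\ 1,\ (r+t)(4r+1),\ 4r(2r+1)(4t-1)\}.$$
   Context: A connected graph $\Gamma$ of diameter $d$ is distance-regular if there are constants $p^h_{ij}$ ($0\le h,i,j\le d$) such that for any two vertices $u,v$ at distance $h$, the number of vertices at distance $i$ from $u$ and distance $j$ from $v$ is $p^h_{ij}$. Its intersection array is $\{b_0,b_1,\dots,b_{d-1};c_1,c_2,\dots,c_d\}$ where $b_i=p^i_{1,i+1}$ and $c_{i+1}=p^{i+1}_{1,i}$. *)

theory Defs
  imports "Graph_Theory.Graph_Theory"
begin

text \<open>Finite simple graphs are the symmetric digraphs of the locale \<^locale>\<open>graph\<close>: finite, without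
  loops, without parallel arcs.\<close>

definition gdist :: "('a, 'b) pre_digraph \<Rightarrow> 'a \<Rightarrow> 'a \<Rightarrow> nat" where
  "gdist G u v = (LEAST n. \<exists>p. pre_digraph.awalk G u p v \<and> length p = n)"

definition gdiameter :: "('a, 'b) pre_digraph \<Rightarrow> nat" where
  "gdiameter G = Max {gdist G u v |u v. u \<in> verts G \<and> v \<in> verts G}"

text \<open>\<open>p h i j\<close> is $p^h_{ij}$; its values at indices above the diameter are unconstrained.\<close>

definition intersection_numbers ::
    "('a, 'b) pre_digraph \<Rightarrow> (nat \<Rightarrow> nat \<Rightarrow> nat \<Rightarrow> nat) \<Rightarrow> bool" where
  "intersection_numbers G p \<longleftrightarrow>
     (\<forall>h \<le> gdiameter G. \<forall>i \<le> gdiameter G. \<forall>j \<le> gdiameter G.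
       \<forall>u \<in> verts G. \<forall>v \<in> verts G. gdist G u v = h \<longrightarrow>
         card {w \<in> verts G. gdist G u w = i \<and> gdist G v w = j} = p h i j)"

definition distance_regular :: "('a, 'b) pre_digraph \<Rightarrow> bool" where
  "distance_regular G \<longleftrightarrow>
     graph G \<and> Digraph_Component.connected G \<and> (\<exists>p. intersection_numbers G p)"

text \<open>In \<open>has_intersection_array G bs cs\<close> the lists are $b_0,\dots,b_{d-1}$ and $c_1,\dots,c_d$,
  where $d$ is the diameter of \<open>G\<close>; so \<open>bs ! i\<close> is $b_i$, but \<open>cs ! i\<close> is $c_{i+1}$.\<close>

definition has_intersection_array :: "('a, 'b) pre_digraph \<Rightarrow> nat list \<Rightarrow> nat list \<Rightarrow> bool" where
  "has_intersection_array G bs cs \<longleftrightarrow>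
     (\<exists>p. intersection_numbers G p \<and>
          bs = map (\<lambda>i. p i 1 (i + 1)) [0..<gdiameter G] \<and>
          cs = map (\<lambda>i. p (i + 1) 1 i) [0..<gdiameter G])"

text \<open>The distance is the library's shortest-path cost for unit weights.\<close>

lemma (in wf_digraph) gdist_eq_mu:
  assumes "u \<rightarrow>\<^sup>* v"
  shows "ereal (real (gdist G u v)) = \<mu> (\<lambda>_. 1) u v"
proof -
  have cost: "awalk_cost (\<lambda>_. 1) p = real (length p)" for p
    by (induction p) (auto simp: awalk_cost_def)
  have ex: "\<exists>n p. awalk u p v \<and> length p = n"
    using assms by (auto simp: reachable_awalk)
  obtain p where p: "awalk u p v" "length p = gdist G u v"
    using LeastI_ex[OF ex] unfolding gdist_def by blast
  have le: "gdist G u v \<le> length q" if "awalk u q v" for q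
    unfolding gdist_def using that by (intro Least_le) blast
  show ?thesis
    unfolding \<mu>_def cost
    by (rule antisym) (auto intro!: INF_greatest INF_lower2[of p] simp: p le)
qed

end

theory Submission
  imports Defs
begin

text \<open>The eigenvalues $(2r+1)(4t-1)$ and $-(2r+1)(4r+1)$ have cosine sequences proportional to
  \<open>f\<close> and \<open>g\<close> below, and the Krein parameter belonging to $f, f, g$ vanishes. Hence
  $\sum_x f(d(u,x)) f(d(v,x)) g(d(w,x)) = 0$ for all vertices $u, v, w$, which is a linear equation
  between triple intersection numbers. For three vertices at mutual distance 3 these equations force
  the $4r$ vertices at distance 3 from two of them to be at mutual distance 3, and no neighbour of one
  of the three to be at distance 3 from both others. Now take $v, x, w$ at mutual distance 3 and a
  neighbour $u$ of $v$ at distance 3 from $x$. Then $d(u,w) = 2$ and $x$ is the only vertex at distance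
  3 from $u, v, w$; the equations for $(u,v,w)$ then say that twice the number of vertices at distances
  $1, 1, 3$ from $u, v, w$ is $4t - 4r - 1$, which is odd.\<close>

section \<open>Eigenmatrices and vanishing Krein parameters\<close>

text \<open>Of the graph only its distance function is kept; adjacency is distance 1. Positivity of
  \<open>b_h\<close> makes every distance up to \<open>D\<close> occur and makes the eigenvalue
  recurrence solvable upwards from index 0.\<close>

locale distance_regular_space =
  fixes V :: "'a set" and d :: "'a \<Rightarrow> 'a \<Rightarrow> nat" and D :: nat
    and p :: "nat \<Rightarrow> nat \<Rightarrow> nat \<Rightarrow> nat"
  assumes finite_V: "finite V" and V_nonempty: "V \<noteq> {}"
    and dist_le: "u \<in> V \<Longrightarrow> v \<in> V \<Longrightarrow> d u v \<le> D"
    and dist_commute: "u \<in> V \<Longrightarrow> v \<in> V \<Longrightarrow> d u v = d v u"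
    and dist_eq_0: "u \<in> V \<Longrightarrow> v \<in> V \<Longrightarrow> d u v = 0 \<longleftrightarrow> u = v"
    and triangle: "u \<in> V \<Longrightarrow> v \<in> V \<Longrightarrow> w \<in> V \<Longrightarrow> d u w \<le> d u v + d v w"
    and count: "u \<in> V \<Longrightarrow> v \<in> V \<Longrightarrow> i \<le> D \<Longrightarrow> j \<le> D \<Longrightarrow>
      card {x \<in> V. d u x = i \<and> d v x = j} = p (d u v) i j"
    and b_pos: "h < D \<Longrightarrow> p h 1 (h + 1) > 0"
begin

section \<open>Counting by distances\<close>

lemma dist_self [simp]: "u \<in> V \<Longrightarrow> d u u = 0"
  by (simp add: dist_eq_0)

text \<open>Start from a pair of equal vertices; \<open>b_pos\<close> replaces one end by a
  neighbour that is one step further from the other end.\<close>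

lemma distance_attained:
  assumes "h \<le> D"
  obtains u v where "u \<in> V" "v \<in> V" "d u v = h"
proof -
  have "\<exists>u\<in>V. \<exists>v\<in>V. d u v = h" using assms
  proof (induction h)
    case 0
    then show ?case using V_nonempty dist_self by blast
  next
    case (Suc h)
    then obtain u v where uv: "u \<in> V" "v \<in> V" "d u v = h" by auto
    have "card {x \<in> V. d u x = 1 \<and> d v x = Suc h} > 0"
      using count[OF uv(1,2), of 1 "Suc h"] b_pos[of h] uv Suc.prems by simp
    then show ?case using uv(2) by (auto simp: card_gt_0_iff)
  qed
  then show ?thesis using that by blast
qed

text \<open>The triangle inequality leaves nothing to count. An actual pair at distance
  \<open>h\<close> is required because \<open>p\<close> is constrained only through such
  pairs.\<close>

lemma intersection_number_eq_0:
  assumes "h \<le> D" "i \<le> D" "j \<le> D" "h > i + j \<or> i > h + j \<or> j > h + i"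
  shows "p h i j = 0"
proof -
  obtain u v where uv: "u \<in> V" "v \<in> V" "d u v = h" using distance_attained assms(1) by blast
  have "{x \<in> V. d u x = i \<and> d v x = j} = {}"
  proof (rule ccontr)
    assume "\<not> ?thesis"
    then obtain x where x: "x \<in> V" "d u x = i" "d v x = j" by blast
    show False
      using triangle[of u x v] triangle[of u v x] triangle[of v u x] dist_commute[of x v]
        dist_commute[of v u] uv x assms(4) by auto
  qed
  then show ?thesis using count[OF uv(1,2) assms(2,3)] uv(3) by (simp only: card.empty)
qed

text \<open>Sort the vertices by their pair of distances to \<open>u\<close> and \<open>v\<close>,
  inserting indicators and exchanging sums.\<close>

lemma sum_two_distances:
  fixes \<phi> :: "nat \<Rightarrow> nat \<Rightarrow> int"
  assumes "u \<in> V" "v \<in> V"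
  shows "(\<Sum>x\<in>V. \<phi> (d u x) (d v x)) = (\<Sum>i\<le>D. \<Sum>j\<le>D. int (p (d u v) i j) * \<phi> i j)"
proof -
  have "(\<Sum>x\<in>V. \<phi> (d u x) (d v x))
      = (\<Sum>x\<in>V. \<Sum>i\<le>D. \<Sum>j\<le>D. of_bool (d u x = i \<and> d v x = j) * \<phi> i j)"
  proof (rule sum.cong[OF refl])
    fix x assume x: "x \<in> V"
    have "(\<Sum>i\<le>D. \<Sum>j\<le>D. of_bool (d u x = i \<and> d v x = j) * \<phi> i j)
        = (\<Sum>i\<le>D. if d u x = i then \<Sum>j\<le>D. if d v x = j then \<phi> i j else 0 else 0)"
      by (intro sum.cong refl) (auto intro!: sum.cong sum.neutral)
    also have "\<dots> = \<phi> (d u x) (d v x)"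
      using dist_le[OF assms(1) x] dist_le[OF assms(2) x] by simp
    finally show "\<phi> (d u x) (d v x)
        = (\<Sum>i\<le>D. \<Sum>j\<le>D. of_bool (d u x = i \<and> d v x = j) * \<phi> i j)" by simp
  qed
  also have "\<dots> = (\<Sum>i\<le>D. \<Sum>j\<le>D. \<Sum>x\<in>V. of_bool (d u x = i \<and> d v x = j) * \<phi> i j)"
    by (subst sum.swap, subst (2) sum.swap) (rule refl)
  also have "\<dots> = (\<Sum>i\<le>D. \<Sum>j\<le>D. int (p (d u v) i j) * \<phi> i j)"
  proof (intro sum.cong refl)
    fix i j assume ij: "i \<in> {..D}" "j \<in> {..D}"
    have "(\<Sum>x\<in>V. of_bool (d u x = i \<and> d v x = j) * \<phi> i j)
        = int (card {x \<in> V. d u x = i \<and> d v x = j}) * \<phi> i j"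
      using finite_V by (simp add: sum_distrib_right[symmetric] Int_def)
    then show "(\<Sum>x\<in>V. of_bool (d u x = i \<and> d v x = j) * \<phi> i j) = int (p (d u v) i j) * \<phi> i j"
      using count assms ij by simp
  qed
  finally show ?thesis .
qed

lemma sum_neighbours:
  fixes \<phi> :: "nat \<Rightarrow> int"
  assumes "u \<in> V" "v \<in> V" "D \<ge> 1"
  shows "(\<Sum>y\<in>{y\<in>V. d u y = 1}. \<phi> (d v y)) = (\<Sum>j\<le>D. int (p (d u v) 1 j) * \<phi> j)"
proof -
  have "(\<Sum>y\<in>{y\<in>V. d u y = 1}. \<phi> (d v y)) = (\<Sum>y\<in>V. if d u y = 1 then \<phi> (d v y) else 0)"
    using finite_V by (simp add: sum.inter_filter)
  also have "\<dots> = (\<Sum>i\<le>D. \<Sum>j\<le>D. int (p (d u v) i j) * (if i = 1 then \<phi> j else 0))"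
    using sum_two_distances[OF assms(1,2), of "\<lambda>i j. if i = 1 then \<phi> j else 0"] by simp
  also have "\<dots> = (\<Sum>i\<le>D. if i = 1 then \<Sum>j\<le>D. int (p (d u v) 1 j) * \<phi> j else 0)"
    by (intro sum.cong refl) auto
  also have "\<dots> = (\<Sum>j\<le>D. int (p (d u v) 1 j) * \<phi> j)"
    using assms(3) by simp
  finally show ?thesis .
qed

lemma sum_one_distance:
  fixes \<phi> :: "nat \<Rightarrow> int"
  assumes "u \<in> V"
  shows "(\<Sum>x\<in>V. \<phi> (d u x)) = (\<Sum>i\<le>D. int (p 0 i i) * \<phi> i)"
proof -
  have "(\<Sum>x\<in>V. \<phi> (d u x)) = (\<Sum>i\<le>D. \<Sum>j\<le>D. int (p 0 i j) * \<phi> i)"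
    using sum_two_distances[OF assms assms, of "\<lambda>i j. \<phi> i"] assms by simp
  also have "\<dots> = (\<Sum>i\<le>D. \<Sum>j\<le>D. if j = i then int (p 0 i i) * \<phi> i else 0)"
    using intersection_number_eq_0[of 0] by (intro sum.cong refl) (auto simp: nat_neq_iff)
  also have "\<dots> = (\<Sum>i\<le>D. int (p 0 i i) * \<phi> i)"
    by simp
  finally show ?thesis .
qed

text \<open>Both sides count the neighbours of a vertex: \<open>p 0 1 1\<close> is the
  valency.\<close>

lemma sum_intersection_numbers_row:
  assumes "h \<le> D" "D \<ge> 1"
  shows "(\<Sum>j\<le>D. int (p h 1 j)) = int (p 0 1 1)"
proof -
  obtain u v where uv: "u \<in> V" "v \<in> V" "d u v = h" using distance_attained assms(1) by blast
  have "(\<Sum>j\<le>D. int (p h 1 j)) = int (card {y \<in> V. d u y = 1})"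
    using sum_neighbours[OF uv(1,2) assms(2), of "\<lambda>_. 1"] uv by simp
  also have "\<dots> = int (p 0 1 1)"
    using count[OF uv(1) uv(1), of 1 1] uv assms(2) by simp
  finally show ?thesis .
qed

section \<open>Eigensequences\<close>

text \<open>A right eigenvector of the tridiagonal intersection matrix, that is, a multiple of a
  cosine sequence. The scale is left free so that integer values suffice.\<close>

definition eigensequence :: "int \<Rightarrow> (nat \<Rightarrow> int) \<Rightarrow> bool" where
  "eigensequence \<theta> g \<longleftrightarrow> (\<forall>h\<le>D. (\<Sum>j\<le>D. int (p h 1 j) * g j) = \<theta> * g h)"

text \<open>Since \<open>b_h > 0\<close>, the recurrence at \<open>h\<close> determines the value at
  \<open>h + 1\<close> from the earlier ones. Cross-multiplication states proportionality without
  division.\<close>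

lemma eigensequence_unique:
  assumes D: "D \<ge> 1" and g: "eigensequence \<theta> g" and g': "eigensequence \<theta> g'" and "h \<le> D"
  shows "g' h * g 0 = g' 0 * g h"
  using \<open>h \<le> D\<close>
proof (induction h rule: less_induct)
  case (less h)
  show ?case
  proof (cases h)
    case 0
    then show ?thesis by simp
  next
    case (Suc m)
    \<comment> \<open>\<open>W\<close> is the defect of proportionality; by linearity it obeys the
      same recurrence.\<close>
    define W where "W j = g' j * g 0 - g' 0 * g j" for j
    have m: "m \<le> D" "m < D" using less.prems Suc by auto
    have "(\<Sum>j\<le>D. int (p m 1 j) * W j)
        = (\<Sum>j\<le>D. int (p m 1 j) * g' j) * g 0 - g' 0 * (\<Sum>j\<le>D. int (p m 1 j) * g j)"
      unfolding sum_distrib_left sum_distrib_right sum_subtractf[symmetric] W_def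
      by (intro sum.cong refl) (simp add: algebra_simps)
    also have "\<dots> = \<theta> * W m"
      using g g' m(1) by (simp add: eigensequence_def W_def algebra_simps)
    also have "W m = 0"
      using less.IH[of m] Suc m(1) by (simp add: W_def)
    finally have 0: "(\<Sum>j\<le>D. int (p m 1 j) * W j) = 0" by simp
    \<comment> \<open>Earlier terms vanish by induction, later ones by the triangle inequality; only
      \<open>b_m\<close> times the next defect remains.\<close>
    have "(\<Sum>j\<le>D. int (p m 1 j) * W j)
        = (\<Sum>j\<le>D. if j = Suc m then int (p m 1 (Suc m)) * W (Suc m) else 0)"
    proof (intro sum.cong refl)
      fix j assume j: "j \<in> {..D}"
      consider "j < Suc m" | "j = Suc m" | "j > Suc m" by linarith
      then show "int (p m 1 j) * W j = (if j = Suc m then int (p m 1 (Suc m)) * W (Suc m) else 0)"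
      proof cases
        case 1
        then have "W j = 0" using less.IH[of j] Suc j by (simp add: W_def)
        then show ?thesis using 1 by simp
      next
        case 3
        then have "p m 1 j = 0" using intersection_number_eq_0[of m 1 j] D j m by simp
        then show ?thesis using 3 by simp
      qed simp
    qed
    then have "int (p m 1 (Suc m)) * W (Suc m) = 0" using 0 less.prems Suc by simp
    then have "W (Suc m) = 0" using b_pos[OF m(2)] by simp
    then show ?thesis using Suc by (simp add: W_def)
  qed
qed

text \<open>The matrix with entries \<open>g (d u v)\<close> is an eigenmatrix of the adjacency matrix, hence so is its
  square; the square again depends on the distance only, so uniqueness makes it a multiple of the
  matrix itself.\<close>

lemma eigensequence_convolution:
  assumes D: "D \<ge> 1" and g: "eigensequence \<theta> g" and uv: "u \<in> V" "v \<in> V"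
  shows "(\<Sum>x\<in>V. g (d u x) * g (d v x)) * g 0 = (\<Sum>i\<le>D. int (p 0 i i) * (g i)\<^sup>2) * g (d u v)"
proof -
  \<comment> \<open>\<open>T h\<close> is the entry of the squared matrix at any pair at distance
    \<open>h\<close>.\<close>
  define T where "T h = (\<Sum>i\<le>D. \<Sum>j\<le>D. int (p h i j) * (g i * g j))" for h
  have T: "(\<Sum>x\<in>V. g (d u x) * g (d v x)) = T (d u v)" if "u \<in> V" "v \<in> V" for u v
    unfolding T_def by (rule sum_two_distances[OF that])
  have "eigensequence \<theta> T"
    unfolding eigensequence_def
  proof (intro allI impI)
    fix h assume "h \<le> D"
    then obtain u v where uv: "u \<in> V" "v \<in> V" "d u v = h" using distance_attained by blast
    have "(\<Sum>j\<le>D. int (p h 1 j) * T j) = (\<Sum>y\<in>{y\<in>V. d u y = 1}. T (d v y))"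
      using sum_neighbours[OF uv(1,2) D, of T] uv(3) by simp
    also have "\<dots> = (\<Sum>y\<in>{y\<in>V. d u y = 1}. \<Sum>x\<in>V. g (d v x) * g (d y x))"
      using uv(2) by (intro sum.cong) (auto simp: T)
    also have "\<dots> = (\<Sum>x\<in>V. g (d v x) * (\<Sum>y\<in>{y\<in>V. d u y = 1}. g (d y x)))"
      by (subst sum.swap) (simp add: sum_distrib_left)
    \<comment> \<open>With the sum over the neighbours of \<open>u\<close> innermost, the eigenvalue
      equation applies to the factor containing \<open>y\<close>.\<close>
    also have "\<dots> = (\<Sum>x\<in>V. g (d v x) * (\<theta> * g (d u x)))"
    proof (intro sum.cong refl arg_cong2[where f="(*)"])
      fix x assume x: "x \<in> V"
      have "(\<Sum>y\<in>{y\<in>V. d u y = 1}. g (d y x)) = (\<Sum>y\<in>{y\<in>V. d u y = 1}. g (d x y))"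
        using x by (intro sum.cong) (auto simp: dist_commute)
      also have "\<dots> = (\<Sum>j\<le>D. int (p (d u x) 1 j) * g j)"
        by (rule sum_neighbours[OF uv(1) x D])
      also have "\<dots> = \<theta> * g (d u x)"
        using g dist_le[OF uv(1) x] by (simp add: eigensequence_def)
      finally show "(\<Sum>y\<in>{y\<in>V. d u y = 1}. g (d y x)) = \<theta> * g (d u x)" .
    qed
    also have "\<dots> = \<theta> * (\<Sum>x\<in>V. g (d u x) * g (d v x))"
      by (simp add: sum_distrib_left mult_ac)
    also have "\<dots> = \<theta> * T h" using T uv by simp
    finally show "(\<Sum>j\<le>D. int (p h 1 j) * T j) = \<theta> * T h" .
  qed
  from eigensequence_unique[OF D g this dist_le[OF uv]]
  have "T (d u v) * g 0 = T 0 * g (d u v)" .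
  moreover have "T 0 = (\<Sum>i\<le>D. int (p 0 i i) * (g i)\<^sup>2)"
    using sum_one_distance[OF uv(1), of "\<lambda>i. (g i)\<^sup>2"] T[OF uv(1) uv(1)] uv(1)
    by (simp add: power2_eq_square)
  ultimately show ?thesis using T[OF uv] by simp
qed

text \<open>Sum \<open>g (d y x)\<close> over the neighbours \<open>y\<close> of a vertex and all
  \<open>x\<close>. Constant row sums give the valency times the sum; the eigenvalue equation gives
  \<open>\<theta>\<close> times it.\<close>

lemma eigensequence_sum_eq_0:
  assumes D: "D \<ge> 1" and g: "eigensequence \<theta> g" and \<theta>: "\<theta> \<noteq> int (p 0 1 1)"
  shows "(\<Sum>i\<le>D. int (p 0 i i) * g i) = 0"
proof -
  obtain u where u: "u \<in> V" using V_nonempty by blast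
  let ?s = "\<Sum>i\<le>D. int (p 0 i i) * g i"
  have "int (p 0 1 1) * ?s = (\<Sum>y\<in>{y\<in>V. d u y = 1}. \<Sum>x\<in>V. g (d y x))"
    using count[OF u u, of 1 1] D u by (simp add: sum_one_distance)
  also have "\<dots> = (\<Sum>x\<in>V. \<Sum>y\<in>{y\<in>V. d u y = 1}. g (d x y))"
    by (subst sum.swap) (intro sum.cong refl, auto simp: dist_commute)
  also have "\<dots> = (\<Sum>x\<in>V. \<theta> * g (d u x))"
    using g dist_le[OF u] sum_neighbours[OF u _ D, of _ g]
    by (intro sum.cong refl) (simp add: eigensequence_def)
  also have "\<dots> = \<theta> * ?s"
    using sum_one_distance[OF u, of g] by (simp add: sum_distrib_left[symmetric])
  finally show ?thesis using \<theta> by simp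
qed

text \<open>A vanishing Krein parameter annihilates the triple product sums: the squares of the sums over
  all triples add up to a multiple of the parameter.\<close>

lemma vanishing_krein_parameter:
  assumes D: "D \<ge> 1"
    and e: "eigensequence \<theta>\<^sub>1 e" "eigensequence \<theta>\<^sub>2 f" "eigensequence \<theta>\<^sub>3 g"
    and nz: "e 0 \<noteq> 0" "f 0 \<noteq> 0" "g 0 \<noteq> 0"
    and krein: "(\<Sum>i\<le>D. int (p 0 i i) * (e i * f i * g i)) = 0"
    and uvw: "u \<in> V" "v \<in> V" "w \<in> V"
  shows "(\<Sum>x\<in>V. e (d u x) * f (d v x) * g (d w x)) = 0"
proof -
  define S where "S u v w = (\<Sum>x\<in>V. e (d u x) * f (d v x) * g (d w x))" for u v w
  \<comment> \<open>\<open>C\<close> and \<open>N\<close> express the matrix squares: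
    \<open>C h x y * h 0 = N h * h (d x y)\<close> for an eigensequence \<open>h\<close>.\<close>
  define C where "C h x y = (\<Sum>u\<in>V. h (d u x) * h (d u y))" for h :: "nat \<Rightarrow> int" and x y
  define N where "N h = (\<Sum>i\<le>D. int (p 0 i i) * (h i)\<^sup>2)" for h :: "nat \<Rightarrow> int"
  have C: "C h x y * h 0 = N h * h (d x y)" if "eigensequence \<theta> h" "x \<in> V" "y \<in> V" for h \<theta> x y
  proof -
    have "C h x y = (\<Sum>u\<in>V. h (d x u) * h (d y u))"
      unfolding C_def using that by (intro sum.cong refl) (simp add: dist_commute)
    then show ?thesis using eigensequence_convolution[OF D that] unfolding N_def by simp
  qed
  have swap: "(\<Sum>a\<in>V. \<Sum>x\<in>V. \<Sum>y\<in>V. F a x y) = (\<Sum>x\<in>V. \<Sum>y\<in>V. \<Sum>a\<in>V. F a x y)"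
    for F :: "'a \<Rightarrow> 'a \<Rightarrow> 'a \<Rightarrow> int"
    by (rule trans[OF sum.swap]) (rule sum.cong[OF refl], rule sum.swap)
  \<comment> \<open>Expanding each square introduces two vertices \<open>x\<close> and
    \<open>y\<close>; for fixed \<open>x\<close>, \<open>y\<close> the sums over \<open>u\<close>,
    \<open>v\<close>, \<open>w\<close> separate into a product.\<close>
  have "(\<Sum>u\<in>V. \<Sum>v\<in>V. \<Sum>w\<in>V. (S u v w)\<^sup>2)
      = (\<Sum>u\<in>V. \<Sum>v\<in>V. \<Sum>w\<in>V. \<Sum>x\<in>V. \<Sum>y\<in>V.
          (e (d u x) * e (d u y)) * ((f (d v x) * f (d v y)) * (g (d w x) * g (d w y))))"
    unfolding S_def power2_eq_square sum_product by (simp add: mult_ac)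
  also have "\<dots> = (\<Sum>u\<in>V. \<Sum>v\<in>V. \<Sum>x\<in>V. \<Sum>y\<in>V. \<Sum>w\<in>V.
          (e (d u x) * e (d u y)) * ((f (d v x) * f (d v y)) * (g (d w x) * g (d w y))))"
    by (rule sum.cong[OF refl], rule sum.cong[OF refl], rule swap)
  also have "\<dots> = (\<Sum>u\<in>V. \<Sum>x\<in>V. \<Sum>y\<in>V. \<Sum>v\<in>V. \<Sum>w\<in>V.
          (e (d u x) * e (d u y)) * ((f (d v x) * f (d v y)) * (g (d w x) * g (d w y))))"
    by (rule sum.cong[OF refl], rule swap)
  also have "\<dots> = (\<Sum>x\<in>V. \<Sum>y\<in>V. \<Sum>u\<in>V. \<Sum>v\<in>V. \<Sum>w\<in>V.
          (e (d u x) * e (d u y)) * ((f (d v x) * f (d v y)) * (g (d w x) * g (d w y))))"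
    by (rule swap)
  also have "\<dots> = (\<Sum>x\<in>V. \<Sum>y\<in>V. C e x y * (C f x y * C g x y))"
    unfolding C_def sum_product[symmetric] sum_distrib_left[symmetric] sum_distrib_right[symmetric]
    by (rule refl)
  \<comment> \<open>The factor \<open>e 0 * f 0 * g 0\<close> supplies the multiplier that each
    convolution identity carries; it is nonzero and cancels at the end.\<close>
  finally have "(\<Sum>u\<in>V. \<Sum>v\<in>V. \<Sum>w\<in>V. (S u v w)\<^sup>2) * (e 0 * f 0 * g 0)
      = (\<Sum>x\<in>V. \<Sum>y\<in>V. (C e x y * e 0) * (C f x y * f 0) * (C g x y * g 0))"
    by (simp add: sum_distrib_left mult_ac)
  also have "\<dots> = (\<Sum>x\<in>V. \<Sum>y\<in>V. (N e * N f * N g) * (e (d x y) * f (d x y) * g (d x y)))"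
    by (intro sum.cong refl) (simp add: C[OF e(1)] C[OF e(2)] C[OF e(3)])
  also have "\<dots> = (\<Sum>x\<in>V. (N e * N f * N g) * (\<Sum>i\<le>D. int (p 0 i i) * (e i * f i * g i)))"
    unfolding sum_distrib_left[symmetric]
    by (intro sum.cong arg_cong2[where f="(*)"] refl)
       (use sum_one_distance[where \<phi>="\<lambda>i. e i * f i * g i"] in simp)
  also have "\<dots> = 0" using krein by simp
  finally have "(\<Sum>u\<in>V. \<Sum>v\<in>V. \<Sum>w\<in>V. (S u v w)\<^sup>2) = 0" using nz by simp
  then have "(S u v w)\<^sup>2 = 0"
    using uvw finite_V by (simp add: sum_nonneg_eq_0_iff sum_nonneg)
  then show ?thesis by (simp add: S_def)
qed

lemma p_000: "p 0 0 0 = 1"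
proof -
  obtain u where u: "u \<in> V" using V_nonempty by blast
  have "{x \<in> V. d u x = 0 \<and> d u x = 0} = {u}" using u dist_eq_0 by auto
  then show ?thesis using count[OF u u, of 0 0] u by simp
qed

section \<open>Triple intersection numbers\<close>

lemma sum_of_bool_eq_card: "(\<Sum>x\<in>V. of_bool (P x)) = int (card {x \<in> V. P x})"
  using finite_V by (simp add: Int_def)

text \<open>The triple intersection number \<open>[i j l]\<close>, taken as an integer because it
  enters linear equations with negative coefficients.\<close>

definition triple :: "'a \<Rightarrow> 'a \<Rightarrow> 'a \<Rightarrow> nat \<Rightarrow> nat \<Rightarrow> nat \<Rightarrow> int" where
  "triple u v w i j l = int (card {x \<in> V. d u x = i \<and> d v x = j \<and> d w x = l})"

lemma triple_nonneg: "triple u v w i j l \<ge> 0"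
  by (simp add: triple_def)

lemma triple_eq_0_D:
  assumes "triple u v w i j l = 0" "x \<in> V" "d u x = i" "d v x = j" "d w x = l"
  shows False
proof -
  have "{x \<in> V. d u x = i \<and> d v x = j \<and> d w x = l} = {}"
    using assms(1) finite_V by (simp add: triple_def)
  then show False using assms(2-) by blast
qed

lemma triple_rotate: "triple v w u j l i = triple u v w i j l"
  unfolding triple_def by (intro arg_cong[where f="\<lambda>A. int (card A)"]) auto

lemma sum_of_bool_self: "u \<in> V \<Longrightarrow> (\<Sum>x\<in>V. of_bool (d u x = 0)) = (1::int)"
proof -
  assume u: "u \<in> V"
  then have "{x \<in> V. d u x = 0} = {u}" using dist_eq_0 by auto
  then show ?thesis by (simp only: sum_of_bool_eq_card) simp
qed

lemma sum_of_bool_triple: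
  "(\<Sum>x\<in>V. of_bool (d u x = i \<and> d v x = j \<and> d w x = l)) = triple u v w i j l"
  by (simp only: sum_of_bool_eq_card triple_def)

end

section \<open>The two-parameter family\<close>

lemma sum_atMost_3: "(\<Sum>i\<le>3. \<phi> i) = \<phi> 0 + \<phi> 1 + \<phi> 2 + (\<phi> (3::nat) :: 'a::comm_monoid_add)"
  by (simp add: numeral_eq_Suc)

lemma le_3_cases: "h \<le> 3 \<Longrightarrow> h = 0 \<or> h = 1 \<or> h = 2 \<or> h = (3::nat)"
  by auto

text \<open>Integer parameters make the subtractions in the array genuine.\<close>

locale two_parameter_array = distance_regular_space V d 3 p
  for V :: "'a set" and d :: "'a \<Rightarrow> 'a \<Rightarrow> nat" and p :: "nat \<Rightarrow> nat \<Rightarrow> nat \<Rightarrow> nat" +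
  fixes r t :: int
  assumes r_pos: "r > 0" and t_pos: "t > 0"
    and b0: "int (p 0 1 1) = (2*r + 1) * (4*r + 1) * (4*t - 1)"
    and b1: "int (p 1 1 2) = 8*r * (4*r*t - r + 2*t)"
    and b2: "int (p 2 1 3) = (r + t) * (4*r + 1)"
    and c1: "int (p 1 1 0) = 1"
    and c2: "int (p 2 1 1) = (r + t) * (4*r + 1)"
    and c3: "int (p 3 1 2) = 4*r * (2*r + 1) * (4*t - 1)"
begin

section \<open>Numerical parameters and two eigensequences\<close>

lemma p_eq_0:
  "p 0 1 0 = 0" "p 0 1 2 = 0" "p 0 1 3 = 0" "p 1 1 3 = 0" "p 2 1 0 = 0" "p 3 1 0 = 0" "p 3 1 1 = 0"
  by (simp_all add: intersection_number_eq_0)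

text \<open>These are \<open>a_h\<close>, obtained from the row sums as valency minus
  \<open>b_h\<close> minus \<open>c_h\<close>.\<close>

lemma a_coefficients:
  "int (p 1 1 1) = (2*r + 1) * (4*t - 1) - 4*r - 1"
  "int (p 2 1 2) = (2*r + 1) * (4*r + 1) * (4*t - 1) - 2 * (r + t) * (4*r + 1)"
  "int (p 3 1 3) = (2*r + 1) * (4*t - 1)"
  using sum_intersection_numbers_row[of 1] sum_intersection_numbers_row[of 2]
    sum_intersection_numbers_row[of 3] p_eq_0 b0 b1 b2 c1 c2 c3
  by (simp_all add: sum_atMost_3 algebra_simps del: One_nat_def)

text \<open>The cosine sequence scaled by \<open>4*r + 1\<close> to clear denominators. Its zero at
  2 removes vertices at distance 2 from the sums below.\<close>

definition f :: "nat \<Rightarrow> int" where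
  "f i = (if i = 0 then 4*r + 1 else if i = 1 then 1 else if i = 3 then -1 else 0)"

definition g :: "nat \<Rightarrow> int" where
  "g i = (if i = 0 then (4*t - 1) * (4*r*t - r + 2*t) else if i = 1 then - (4*r*t - r + 2*t)
    else if i = 2 then r + t else - r * (4*t - 1))"

lemma f_simps: "f 0 = 4*r + 1" "f 1 = 1" "f 2 = 0" "f 3 = -1"
  by (simp_all add: f_def)

lemma g_simps: "g 0 = (4*t - 1) * (4*r*t - r + 2*t)" "g 1 = - (4*r*t - r + 2*t)" "g 2 = r + t"
  "g 3 = - r * (4*t - 1)"
  by (simp_all add: g_def)

lemma eigensequence_f: "eigensequence ((2*r + 1) * (4*t - 1)) f"
  unfolding eigensequence_def sum_atMost_3
  by (auto dest!: le_3_cases simp: f_simps p_eq_0 b0 b1 b2 c1 c2 c3 a_coefficients algebra_simps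
      simp del: One_nat_def)

lemma eigensequence_g: "eigensequence (- (2*r + 1) * (4*r + 1)) g"
  unfolding eigensequence_def sum_atMost_3
  by (auto dest!: le_3_cases simp: g_simps p_eq_0 b0 b1 b2 c1 c2 c3 a_coefficients algebra_simps
      simp del: One_nat_def)

text \<open>Orthogonality of \<open>f\<close> to the constants; as \<open>f 2 = 0\<close>, the
  relation involves only the valencies at distances 0, 1 and 3.\<close>

lemma k3: "int (p 0 3 3) = (4*r + 1) * ((2*r + 1) * (4*t - 1) + 1)"
proof -
  have "(2*r + 1) * (4*t - 1) > 0" using r_pos t_pos by simp
  then have "(2*r + 1) * (4*t - 1) \<noteq> int (p 0 1 1)"
    unfolding b0 using r_pos t_pos by simp
  from eigensequence_sum_eq_0[OF _ eigensequence_f this] show ?thesis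
    by (simp add: sum_atMost_3 f_simps p_000 b0 algebra_simps del: One_nat_def)
qed

text \<open>The convolution identity, with weighted square norm
  \<open>8*t * (2*r + 1) * f 0\<close>; the common factor \<open>f 0\<close> cancels.\<close>

lemma sum_f_f:
  assumes "u \<in> V" "v \<in> V"
  shows "(\<Sum>x\<in>V. f (d u x) * f (d v x)) = 8*t * (2*r + 1) * f (d u v)"
proof -
  have "(\<Sum>x\<in>V. f (d u x) * f (d v x)) * f 0 = (\<Sum>i\<le>3. int (p 0 i i) * (f i)\<^sup>2) * f (d u v)"
    by (rule eigensequence_convolution[OF _ eigensequence_f assms]) simp
  also have "(\<Sum>i\<le>3. int (p 0 i i) * (f i)\<^sup>2) = 8*t * (2*r + 1) * f 0"
    by (simp add: sum_atMost_3 f_simps p_000 b0 k3 algebra_simps power2_eq_square del: One_nat_def)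
  finally have "f 0 * (\<Sum>x\<in>V. f (d u x) * f (d v x)) = f 0 * (8*t * (2*r + 1) * f (d u v))"
    by (simp only: mult_ac)
  moreover have "f 0 \<noteq> 0" using r_pos by (simp add: f_simps)
  ultimately show ?thesis by simp
qed

text \<open>Evaluate \<open>sum_f_f\<close> at distance 3: the surviving terms involve the two end
  vertices, \<open>a_3\<close> twice, and the unknown \<open>p 3 3 3\<close>.\<close>

lemma p_333: "int (p 3 3 3) = 4*r"
proof -
  obtain u v where uv: "u \<in> V" "v \<in> V" "d u v = 3" using distance_attained[of 3] by auto
  have p3: "p 3 0 0 = 0" "p 3 0 1 = 0" "p 3 0 2 = 0" "p 3 2 0 = 0"
    by (simp_all add: intersection_number_eq_0)
  have "{x \<in> V. d u x = 0 \<and> d v x = 3} = {u}" using uv dist_eq_0 dist_commute by auto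
  then have p303: "p 3 0 3 = 1" using count[OF uv(1,2), of 0 3] uv by simp
  have "{x \<in> V. d u x = 3 \<and> d v x = 0} = {v}" using uv dist_eq_0 dist_commute by auto
  then have p330: "p 3 3 0 = 1" using count[OF uv(1,2), of 3 0] uv by simp
  have "{x \<in> V. d u x = 3 \<and> d v x = 1} = {x \<in> V. d v x = 1 \<and> d u x = 3}" by auto
  then have p331: "p 3 3 1 = p 3 1 3"
    using count[OF uv(1,2), of 3 1] count[OF uv(2,1), of 1 3] dist_commute[OF uv(1,2)] uv(3) by simp
  have "(\<Sum>i\<le>3. \<Sum>j\<le>3. int (p 3 i j) * (f i * f j)) = 8*t * (2*r + 1) * f 3"
    using sum_two_distances[OF uv(1,2), of "\<lambda>i j. f i * f j"] sum_f_f[OF uv(1,2)] uv(3) by simp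
  then show ?thesis
    by (simp add: sum_atMost_3 f_simps p_eq_0 p3 p303 p330 p331 a_coefficients algebra_simps
        del: One_nat_def)
qed

text \<open>Up to the factor \<open>t\<close>, this is \<open>g\<close> shifted by a constant so as to vanish at 2.\<close>

definition g' :: "nat \<Rightarrow> int" where
  "g' i = (if i = 0 then 16*r*t - 8*r + 8*t - 3 else if i = 1 then - (4*r + 3)
    else if i = 3 then - (4*r + 1) else 0)"

lemma g'_simps: "g' 0 = 16*r*t - 8*r + 8*t - 3" "g' 1 = - (4*r + 3)" "g' 2 = 0" "g' 3 = - (4*r + 1)"
  by (simp_all add: g'_def)

text \<open>Subtracting \<open>r + t\<close> from \<open>g\<close> turns the vanishing triple sum
  into a multiple of \<open>sum_f_f\<close>. Now all three factors vanish at 2, so only distances 0,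
  1 and 3 contribute.\<close>

lemma krein_sum:
  assumes "u \<in> V" "v \<in> V" "w \<in> V"
  shows "(\<Sum>x\<in>V. f (d u x) * f (d v x) * g' (d w x)) = - 8 * (r + t) * (2*r + 1) * f (d u v)"
proof -
  have q: "4*r*t - r + 2*t > 0"
  proof -
    have "4*r*t - r + 2*t = r * (4*t - 1) + 2*t" by (simp add: algebra_simps)
    then show ?thesis using r_pos t_pos by (simp add: add_pos_pos)
  qed
  have "(\<Sum>x\<in>V. f (d u x) * f (d v x) * g (d w x)) = 0"
  proof (rule vanishing_krein_parameter[OF _ eigensequence_f eigensequence_f eigensequence_g])
    \<comment> \<open>The Krein parameter is zero as a polynomial in \<open>r\<close> and
      \<open>t\<close>.\<close>
    show "(\<Sum>i\<le>3. int (p 0 i i) * (f i * f i * g i)) = 0"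
      by (simp add: sum_atMost_3 f_simps g_simps p_000 b0 k3 algebra_simps del: One_nat_def)
  qed (use r_pos t_pos q assms in \<open>simp_all add: f_simps g_simps\<close>)
  moreover have "t * (f (d u x) * f (d v x) * g' (d w x))
      = f (d u x) * f (d v x) * g (d w x) - (r + t) * (f (d u x) * f (d v x))" if "x \<in> V" for x
  proof -
    have "t * g' l = g l - (r + t)" if "l \<le> 3" for l
      using le_3_cases[OF that] by (auto simp: g_simps g'_simps algebra_simps simp del: One_nat_def)
    from this[OF dist_le[OF assms(3) that]] show ?thesis
      by algebra
  qed
  ultimately have "t * (\<Sum>x\<in>V. f (d u x) * f (d v x) * g' (d w x))
      = - ((r + t) * (\<Sum>x\<in>V. f (d u x) * f (d v x)))"
    by (simp add: sum_distrib_left sum_subtractf sum_negf)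
  also have "\<dots> = t * (- 8 * (r + t) * (2*r + 1) * f (d u v))"
    using sum_f_f[OF assms(1,2)] by (simp add: algebra_simps)
  finally show ?thesis using t_pos by simp
qed

section \<open>Three vertices at mutual distance 3\<close>

lemma krein_equation_333:
  assumes uvw: "u \<in> V" "v \<in> V" "w \<in> V" and dist: "d u v = 3" "d u w = 3" "d v w = 3"
  shows "(4*r + 1) * (triple u v w 1 3 3 + triple u v w 3 1 3) - (4*r + 3) * triple u v w 3 3 1
    = (4*r + 1) * (triple u v w 3 3 3 - (4*r - 1))"
proof -
  \<comment> \<open>The pairwise sums are at least 3, so distance 0 forces 3 from the other two
    vertices, and at most one distance is 1. This leaves the listed nonzero patterns.\<close>
  have pointwise: "f i * f j * g' l =
      (4*r + 1)\<^sup>2 * (of_bool (i = 0) + of_bool (j = 0)) + g' 0 * of_bool (l = 0)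
      + (4*r + 1) * (of_bool (i = 1 \<and> j = 3 \<and> l = 3) + of_bool (i = 3 \<and> j = 1 \<and> l = 3))
      - (4*r + 3) * of_bool (i = 3 \<and> j = 3 \<and> l = 1)
      - (4*r + 1) * of_bool (i = 3 \<and> j = 3 \<and> l = 3)"
    if "i \<le> 3" "j \<le> 3" "l \<le> 3" "3 \<le> i + j" "3 \<le> i + l" "3 \<le> j + l" for i j l
    using that(4-) le_3_cases[OF that(1)] le_3_cases[OF that(2)] le_3_cases[OF that(3)]
    by (elim disjE; simp add: f_def g'_def power2_eq_square algebra_simps)
  have "(\<Sum>x\<in>V. f (d u x) * f (d v x) * g' (d w x)) = (\<Sum>x\<in>V.
      (4*r + 1)\<^sup>2 * (of_bool (d u x = 0) + of_bool (d v x = 0)) + g' 0 * of_bool (d w x = 0)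
      + (4*r + 1) * (of_bool (d u x = 1 \<and> d v x = 3 \<and> d w x = 3)
        + of_bool (d u x = 3 \<and> d v x = 1 \<and> d w x = 3))
      - (4*r + 3) * of_bool (d u x = 3 \<and> d v x = 3 \<and> d w x = 1)
      - (4*r + 1) * of_bool (d u x = 3 \<and> d v x = 3 \<and> d w x = 3))"
  proof (rule sum.cong[OF refl], rule pointwise)
    fix x assume x: "x \<in> V"
    show "d u x \<le> 3" "d v x \<le> 3" "d w x \<le> 3" using uvw x by (auto intro: dist_le)
    show "3 \<le> d u x + d v x" "3 \<le> d u x + d w x" "3 \<le> d v x + d w x"
      using triangle[of u x v] triangle[of u x w] triangle[of v x w] uvw dist x
      by (simp_all add: dist_commute[of x])
  qed
  also have "\<dots> = (4*r + 1)\<^sup>2 * 2 + g' 0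
      + (4*r + 1) * (triple u v w 1 3 3 + triple u v w 3 1 3)
      - (4*r + 3) * triple u v w 3 3 1 - (4*r + 1) * triple u v w 3 3 3"
    by (simp only: sum.distrib sum_subtractf sum_distrib_left[symmetric] sum_of_bool_self[OF uvw(1)]
        sum_of_bool_self[OF uvw(2)] sum_of_bool_self[OF uvw(3)] sum_of_bool_triple) simp
  finally show ?thesis
    using krein_sum[OF uvw] dist by (simp add: f_simps g'_simps power2_eq_square algebra_simps)
qed

text \<open>The sum of the three rotated equations equates a nonnegative quantity with a nonpositive
  one, so both vanish.\<close>

lemma triple_333:
  assumes uvw: "u \<in> V" "v \<in> V" "w \<in> V" and dist: "d u v = 3" "d u w = 3" "d v w = 3"
  shows "triple u v w 1 3 3 = 0" "triple u v w 3 3 3 = 4*r - 1"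
proof -
  have sym: "d v u = 3" "d w u = 3" "d w v = 3" using dist dist_commute uvw by auto
  let ?y1 = "triple u v w 1 3 3" and ?y2 = "triple u v w 3 1 3" and ?y3 = "triple u v w 3 3 1"
    and ?z = "triple u v w 3 3 3"
  have e1: "(4*r + 1) * (?y1 + ?y2) - (4*r + 3) * ?y3 = (4*r + 1) * (?z - (4*r - 1))"
    by (rule krein_equation_333) (fact assms)+
  have e2: "(4*r + 1) * (?y2 + ?y3) - (4*r + 3) * ?y1 = (4*r + 1) * (?z - (4*r - 1))"
    using krein_equation_333[of v w u] uvw dist sym by (simp add: triple_rotate)
  have e3: "(4*r + 1) * (?y3 + ?y1) - (4*r + 3) * ?y2 = (4*r + 1) * (?z - (4*r - 1))"
    using krein_equation_333[of w u v] uvw dist sym by (simp add: triple_rotate)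
  have total: "(4*r - 1) * (?y1 + ?y2 + ?y3) = 3 * ((4*r + 1) * (?z - (4*r - 1)))"
    using e1 e2 e3 by (simp add: algebra_simps)
  \<comment> \<open>Among the \<open>4*r\<close> vertices at distance 3 from \<open>v\<close> and
    \<open>w\<close> is \<open>u\<close> itself, which is not counted in \<open>?Z\<close>.\<close>
  have z: "?z \<le> 4*r - 1"
  proof -
    let ?Z = "{x \<in> V. d u x = 3 \<and> d v x = 3 \<and> d w x = 3}"
    have "card (insert u ?Z) \<le> card {x \<in> V. d v x = 3 \<and> d w x = 3}"
      using uvw sym finite_V by (intro card_mono) auto
    moreover have "u \<notin> ?Z" using uvw by simp
    ultimately have "card ?Z + 1 \<le> p 3 3 3"
      using count[OF uvw(2,3), of 3 3] dist(3) finite_V by simp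
    then show ?thesis using p_333 by (simp add: triple_def)
  qed
  have nonneg: "?y1 \<ge> 0" "?y2 \<ge> 0" "?y3 \<ge> 0" by (rule triple_nonneg)+
  have r: "4*r - 1 > 0" "4*r + 1 > 0" using r_pos by auto
  have "(4*r - 1) * (?y1 + ?y2 + ?y3) \<ge> 0" using nonneg r by simp
  moreover have "(4*r + 1) * (?z - (4*r - 1)) \<le> 0"
    using z r by (simp add: mult_nonneg_nonpos)
  ultimately have "(4*r + 1) * (?z - (4*r - 1)) = 0" "(4*r - 1) * (?y1 + ?y2 + ?y3) = 0"
    using total by linarith+
  then have "?z - (4*r - 1) = 0" "?y1 + ?y2 + ?y3 = 0" using r by auto
  then show "?y1 = 0" "?z = 4*r - 1" using nonneg by linarith+
qed

text \<open>By \<open>triple_333\<close>, \<open>u\<close> and the vertices at distance 3 from all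
  of \<open>u\<close>, \<open>v\<close>, \<open>w\<close> number \<open>4*r\<close>, so they exhaust
  the vertices at distance 3 from \<open>v\<close> and \<open>w\<close>.\<close>

lemma distance_3_clique:
  assumes V: "u \<in> V" "v \<in> V" "w \<in> V" "x \<in> V"
    and dist: "d u v = 3" "d u w = 3" "d v w = 3" "d x v = 3" "d x w = 3" and ne: "x \<noteq> u"
  shows "d x u = 3"
proof -
  let ?Z = "{x \<in> V. d u x = 3 \<and> d v x = 3 \<and> d w x = 3}"
    and ?P = "{x \<in> V. d v x = 3 \<and> d w x = 3}"
  have "int (card (insert u ?Z)) = 4*r"
    using triple_333(2)[OF V(1-3) dist(1-3)] V finite_V by (simp add: triple_def)
  also have "\<dots> = int (card ?P)" using count[OF V(2,3), of 3 3] dist(3) p_333 by simp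
  finally have "card (insert u ?Z) = card ?P" by simp
  moreover have "insert u ?Z \<subseteq> ?P" using V dist dist_commute by auto
  ultimately have "insert u ?Z = ?P" using finite_V by (intro card_subset_eq) auto
  moreover have "x \<in> ?P" using V dist dist_commute by auto
  ultimately have "x \<in> insert u ?Z" by blast
  then show ?thesis using ne V dist_commute by auto
qed

section \<open>Three vertices at distances 1, 2, 3\<close>

text \<open>Placing \<open>g'\<close> at \<open>w\<close> and then at \<open>u\<close> gives two
  equations in the same three triple numbers; eliminating \<open>?Y\<close> gives the claim.\<close>

lemma krein_equation_123:
  assumes uvw: "u \<in> V" "v \<in> V" "w \<in> V" and dist: "d u v = 1" "d u w = 2" "d v w = 3"
  shows "2 * triple u v w 1 1 3 = (4*r + 1) * triple u v w 3 3 3 - 2 * (4*r + 1) + 4 * (r + t)"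
proof -
  let ?X = "triple u v w 1 1 3" and ?Y = "triple u v w 3 3 1" and ?Z = "triple u v w 3 3 3"
  have bounds: "d u x \<le> 3" "d v x \<le> 3" "d w x \<le> 3" "d u x \<le> d v x + 1" "d v x \<le> d u x + 1"
    "d w x \<le> d u x + 2" "d u x \<le> d w x + 2" "2 \<le> d u x + d w x" "3 \<le> d v x + d w x"
    if x: "x \<in> V" for x
    using triangle[of u v x] triangle[of v u x] triangle[of w u x] triangle[of u w x]
      triangle[of u x w] triangle[of v x w] uvw dist x
    by (auto simp: dist_commute[of x] dist_commute[of v u] dist_commute[of w u] intro: dist_le)
  \<comment> \<open>Under these bounds the nonzero patterns are \<open>(1,0,3)\<close>, which is
    \<open>v\<close> itself, and \<open>(1,1,3)\<close>, \<open>(3,3,1)\<close>,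
    \<open>(3,3,3)\<close>.\<close>
  have pointwise: "f i * f j * g' l = - ((4*r + 1)\<^sup>2 * of_bool (j = 0))
      - (4*r + 1) * of_bool (i = 1 \<and> j = 1 \<and> l = 3)
      - (4*r + 3) * of_bool (i = 3 \<and> j = 3 \<and> l = 1)
      - (4*r + 1) * of_bool (i = 3 \<and> j = 3 \<and> l = 3)"
    "f j * f l * g' i = (4*r + 3) * (4*r + 1) * of_bool (j = 0)
      + (4*r + 3) * of_bool (i = 1 \<and> j = 1 \<and> l = 3)
      + (4*r + 1) * of_bool (i = 3 \<and> j = 3 \<and> l = 1)
      - (4*r + 1) * of_bool (i = 3 \<and> j = 3 \<and> l = 3)"
    if "i \<le> 3" "j \<le> 3" "l \<le> 3" "i \<le> j + 1" "j \<le> i + 1" "l \<le> i + 2" "i \<le> l + 2"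
      "2 \<le> i + l" "3 \<le> j + l" for i j l
    using that(4-) le_3_cases[OF that(1)] le_3_cases[OF that(2)] le_3_cases[OF that(3)]
    by (elim disjE; simp add: f_def g'_def power2_eq_square algebra_simps)+
  have "(\<Sum>x\<in>V. f (d u x) * f (d v x) * g' (d w x)) = (\<Sum>x\<in>V.
      - ((4*r + 1)\<^sup>2 * of_bool (d v x = 0))
      - (4*r + 1) * of_bool (d u x = 1 \<and> d v x = 1 \<and> d w x = 3)
      - (4*r + 3) * of_bool (d u x = 3 \<and> d v x = 3 \<and> d w x = 1)
      - (4*r + 1) * of_bool (d u x = 3 \<and> d v x = 3 \<and> d w x = 3))"
    by (rule sum.cong[OF refl], rule pointwise(1); rule bounds)
  also have "\<dots> = - (4*r + 1)\<^sup>2 - (4*r + 1) * ?X - (4*r + 3) * ?Y - (4*r + 1) * ?Z"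
    by (simp only: sum.distrib sum_subtractf sum_negf sum_distrib_left[symmetric]
        sum_of_bool_self[OF uvw(2)] sum_of_bool_triple mult_1_right)
  finally have eq1: "(4*r + 1) * ?X + (4*r + 3) * ?Y + (4*r + 1) * ?Z + (4*r + 1)\<^sup>2
      = 8 * (r + t) * (2*r + 1)"
    using krein_sum[OF uvw] dist(1) by (simp add: f_simps algebra_simps del: One_nat_def)
  have "(\<Sum>x\<in>V. f (d v x) * f (d w x) * g' (d u x)) = (\<Sum>x\<in>V.
      (4*r + 3) * (4*r + 1) * of_bool (d v x = 0)
      + (4*r + 3) * of_bool (d u x = 1 \<and> d v x = 1 \<and> d w x = 3)
      + (4*r + 1) * of_bool (d u x = 3 \<and> d v x = 3 \<and> d w x = 1)
      - (4*r + 1) * of_bool (d u x = 3 \<and> d v x = 3 \<and> d w x = 3))"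
    by (rule sum.cong[OF refl], rule pointwise(2); rule bounds)
  also have "\<dots> = (4*r + 3) * (4*r + 1) + (4*r + 3) * ?X + (4*r + 1) * ?Y - (4*r + 1) * ?Z"
    by (simp only: sum.distrib sum_subtractf sum_distrib_left[symmetric]
        sum_of_bool_self[OF uvw(2)] sum_of_bool_triple mult_1_right)
  finally have eq2: "(4*r + 3) * (4*r + 1) + (4*r + 3) * ?X + (4*r + 1) * ?Y - (4*r + 1) * ?Z
      = 8 * (r + t) * (2*r + 1)"
    using krein_sum[OF uvw(2,3,1)] dist(3) by (simp add: f_simps algebra_simps)
  \<comment> \<open>This is \<open>4*r + 3\<close> times \<open>eq2\<close> minus
    \<open>4*r + 1\<close> times \<open>eq1\<close>.\<close>
  have "4 * (2*r + 1) * (2 * ?X) = 4 * (2*r + 1) * ((4*r + 1) * ?Z - 2 * (4*r + 1) + 4 * (r + t))"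
    using eq1 eq2 by algebra
  then show ?thesis using r_pos by simp
qed

section \<open>The parity contradiction\<close>

lemma no_such_array: False
proof -
  obtain v x where vx: "v \<in> V" "x \<in> V" "d v x = 3" using distance_attained[of 3] by auto
  have "p 3 3 3 > 0" using p_333 r_pos by simp
  then have "{w \<in> V. d v w = 3 \<and> d x w = 3} \<noteq> {}"
    using count[OF vx(1,2), of 3 3] vx(3) by (metis card.empty less_irrefl order_refl)
  then obtain w where w: "w \<in> V" "d v w = 3" "d x w = 3" by blast
  \<comment> \<open>Positivity of \<open>a_3\<close> provides the neighbour \<open>u\<close> of
    \<open>v\<close> at distance 3 from \<open>x\<close>.\<close>
  have "int (p 3 1 3) > 0" using a_coefficients(3) r_pos t_pos by simp
  then have "{u \<in> V. d v u = 1 \<and> d x u = 3} \<noteq> {}"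
    using count[OF vx(1,2), of 1 3] vx(3)
    by (metis card.empty int_ops(1) less_irrefl order_refl one_le_numeral)
  then obtain u where u: "u \<in> V" "d v u = 1" "d x u = 3" by blast
  have no_133: "\<not> (d v u = 1 \<and> d y u = 3 \<and> d z u = 3)"
    if "y \<in> V" "z \<in> V" "d v y = 3" "d v z = 3" "d y z = 3" for y z
    using triple_eq_0_D[OF triple_333(1)[OF vx(1) that(1,2)] u(1)] that by blast
  have "d w u \<noteq> 3" using no_133[of x w] vx w u by auto
  moreover have "d w u \<le> 3" using dist_le w u by blast
  moreover have "2 \<le> d w u" using triangle[of v u w] vx w u dist_commute by auto
  ultimately have uw: "d u w = 2" using dist_commute[of u w] u w by auto
  have uv: "d u v = 1" using dist_commute u vx by auto
  \<comment> \<open>A second such vertex \<open>y\<close> would form a mutual distance 3 triple with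
    \<open>v\<close> and \<open>x\<close>, and \<open>u\<close> would contradict
    \<open>no_133\<close>.\<close>
  have "{y \<in> V. d u y = 3 \<and> d v y = 3 \<and> d w y = 3} = {x}"
  proof (intro subset_antisym subsetI)
    fix y assume "y \<in> {y \<in> V. d u y = 3 \<and> d v y = 3 \<and> d w y = 3}"
    then have y: "y \<in> V" "d u y = 3" "d v y = 3" "d w y = 3" by auto
    have "y = x"
    proof (rule ccontr)
      assume "y \<noteq> x"
      then have "d y x = 3"
        using distance_3_clique[of x v w y] vx w y dist_commute by auto
      then show False using no_133[of y x] vx y u dist_commute by auto
    qed
    then show "y \<in> {x}" by simp
  qed (use vx w u dist_commute in auto)
  then have "triple u v w 3 3 3 = 1" by (simp add: triple_def)
  then have "2 * triple u v w 1 1 3 = 4*r + 1 - 2 * (4*r + 1) + 4 * (r + t)"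
    using krein_equation_123[OF u(1) vx(1) w(1) uv uw w(2)] by simp
  \<comment> \<open>The right-hand side equals \<open>4*t - 1\<close>, which is odd.\<close>
  then show False by presburger
qed

end

section \<open>Graph distance\<close>

lemma (in wf_digraph) gdist_le_length: "awalk u q v \<Longrightarrow> gdist G u v \<le> length q"
  unfolding gdist_def by (intro Least_le) blast

lemma (in wf_digraph) gdist_awalkE:
  assumes "u \<rightarrow>\<^sup>* v"
  obtains q where "awalk u q v" "length q = gdist G u v"
proof -
  have "\<exists>n q. awalk u q v \<and> length q = n"
    using assms by (auto simp: reachable_awalk)
  from LeastI_ex[OF this] show ?thesis using that unfolding gdist_def by blast
qed

lemma (in wf_digraph) gdist_triangle:
  assumes "u \<rightarrow>\<^sup>* v" "v \<rightarrow>\<^sup>* w"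
  shows "gdist G u w \<le> gdist G u v + gdist G v w"
proof -
  obtain q q' where "awalk u q v" "length q = gdist G u v" "awalk v q' w" "length q' = gdist G v w"
    using assms by (metis gdist_awalkE)
  then show ?thesis using gdist_le_length[OF awalk_appendI] by (metis length_append)
qed

lemma (in wf_digraph) gdist_eq_0_iff:
  assumes "u \<rightarrow>\<^sup>* v"
  shows "gdist G u v = 0 \<longleftrightarrow> u = v"
proof
  assume "gdist G u v = 0"
  then obtain q where "awalk u q v" "length q = 0" using assms by (metis gdist_awalkE)
  then show "u = v" by (simp add: awalk_Nil_iff)
next
  assume "u = v"
  then have "awalk u [] v" using assms by (auto simp: awalk_Nil_iff reachable_in_verts)
  then show "gdist G u v = 0" using gdist_le_length by fastforce
qed

lemma (in sym_digraph) awalk_reverse: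
  assumes "awalk u q v"
  shows "\<exists>q'. awalk v q' u \<and> length q' = length q"
  using assms
proof (induction q arbitrary: u)
  case Nil
  then show ?case by (auto simp: awalk_Nil_iff)
next
  case (Cons e es)
  then have e: "e \<in> arcs G" "u = tail G e" "awalk (head G e) es v" by (auto simp: awalk_Cons_iff)
  then obtain q' where q': "awalk v q' (head G e)" "length q' = length es" using Cons.IH by blast
  have "(tail G e, head G e) \<in> arcs_ends G" using e(1) by (auto simp: arcs_ends_conv)
  then have "(head G e, tail G e) \<in> arcs_ends G" using sym_arcs by (auto simp: symmetric_def sym_def)
  then obtain e' where e': "e' \<in> arcs G" "tail G e' = head G e" "head G e' = tail G e"
    by (auto simp: arcs_ends_conv)
  then have "awalk (head G e) [e'] u" using e(2) arc_implies_awalk[of e'] by simp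
  then have "awalk v (q' @ [e']) u" using q'(1) by (blast intro: awalk_appendI)
  then show ?case using q'(2) by (intro exI[of _ "q' @ [e']"]) simp
qed

lemma (in sym_digraph) gdist_commute:
  assumes "u \<rightarrow>\<^sup>* v"
  shows "gdist G u v = gdist G v u"
proof -
  have le: "gdist G v u \<le> gdist G u v" if "u \<rightarrow>\<^sup>* v" for u v
    using that awalk_reverse gdist_le_length by (metis gdist_awalkE)
  have "v \<rightarrow>\<^sup>* u" using assms by (rule symmetric_reachable')
  then show ?thesis using le assms by (simp add: antisym)
qed

lemma (in fin_digraph) gdist_le_gdiameter:
  assumes "u \<in> verts G" "v \<in> verts G"
  shows "gdist G u v \<le> gdiameter G"
proof -
  have "{gdist G u v |u v. u \<in> verts G \<and> v \<in> verts G}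
      = (\<lambda>(u, v). gdist G u v) ` (verts G \<times> verts G)" by auto
  then have "finite {gdist G u v |u v. u \<in> verts G \<and> v \<in> verts G}" by simp
  then show ?thesis unfolding gdiameter_def using assms by (intro Max_ge) auto
qed

section \<open>From graphs to the abstract distance setting\<close>

lemma (in graph) distance_regular_space_gdist:
  assumes connected: "Digraph_Component.connected G" and p: "intersection_numbers G p"
    and b: "\<And>h. h < gdiameter G \<Longrightarrow> p h 1 (h + 1) > 0"
  shows "distance_regular_space (verts G) (gdist G) (gdiameter G) p"
proof -
  \<comment> \<open>Connectedness means strong connectedness of the symmetric closure; the arcs are
    already symmetric, so reachability is unchanged.\<close>
  have sc: "verts G \<noteq> {}" "\<And>u v. u \<in> verts G \<Longrightarrow> v \<in> verts G \<Longrightarrow> u \<rightarrow>\<^sup>* v"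
    using connected reachable_mk_symmetric_eq[OF sym_arcs]
    by (auto simp: Digraph_Component.connected_def strongly_connected_def)
  show ?thesis
  proof
    fix u v i j assume "u \<in> verts G" "v \<in> verts G" "i \<le> gdiameter G" "j \<le> gdiameter G"
    then show "card {x \<in> verts G. gdist G u x = i \<and> gdist G v x = j} = p (gdist G u v) i j"
      using p gdist_le_gdiameter unfolding intersection_numbers_def by blast
  qed (use sc b in \<open>auto simp: gdist_le_gdiameter gdist_eq_0_iff gdist_commute gdist_triangle\<close>)
qed

theorem theorem3:
  fixes r t :: nat
  assumes "r > 0" and "t > 0"
  shows "\<not> (\<exists>G :: ('a, 'b) pre_digraph. distance_regular G \<and>
           has_intersection_array G
             [(2*r + 1) * (4*r + 1) * (4*t - 1), 8*r * (4*r*t - r + 2*t), (r + t) * (4*r + 1)]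
             [1, (r + t) * (4*r + 1), 4*r * (2*r + 1) * (4*t - 1)])"
proof
  assume "\<exists>G :: ('a, 'b) pre_digraph. distance_regular G \<and>
           has_intersection_array G
             [(2*r + 1) * (4*r + 1) * (4*t - 1), 8*r * (4*r*t - r + 2*t), (r + t) * (4*r + 1)]
             [1, (r + t) * (4*r + 1), 4*r * (2*r + 1) * (4*t - 1)]"
    (is "\<exists>G. _ \<and> has_intersection_array G ?bs ?cs")
  then obtain G :: "('a, 'b) pre_digraph"
    where dr: "distance_regular G" and ia: "has_intersection_array G ?bs ?cs"
    by (elim exE conjE)
  from dr have G: "graph G" "Digraph_Component.connected G"
    by (simp_all add: distance_regular_def)
  from ia obtain p where p: "intersection_numbers G p"
    and bs: "?bs = map (\<lambda>i. p i 1 (i + 1)) [0..<gdiameter G]"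
    and cs: "?cs = map (\<lambda>i. p (i + 1) 1 i) [0..<gdiameter G]"
    unfolding has_intersection_array_def by (elim exE conjE)
  have "length ?bs = gdiameter G" unfolding bs by simp
  then have diam: "gdiameter G = 3" by simp
  have upt: "[0..<3] = [0, 1, 2]" by (simp add: upt_rec)
  have b: "p 0 1 1 = (2*r + 1) * (4*r + 1) * (4*t - 1)" "p 1 1 2 = 8*r * (4*r*t - r + 2*t)"
    "p 2 1 3 = (r + t) * (4*r + 1)"
    using bs unfolding diam upt by (simp_all del: One_nat_def)
  have c: "p 1 1 0 = 1" "p 2 1 1 = (r + t) * (4*r + 1)" "p 3 1 2 = 4*r * (2*r + 1) * (4*t - 1)"
    using cs unfolding diam upt by (simp_all del: One_nat_def)
  \<comment> \<open>These bounds keep the natural-number subtractions in the array from truncating,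
    so they agree with the integer ones.\<close>
  have le: "r \<le> 4*r*t" "1 \<le> 4*t" using assms by simp_all
  interpret distance_regular_space "verts G" "gdist G" 3 p
  proof -
    have "4*r*t - r + 2*t > 0" using assms(2) by (intro trans_less_add2) simp
    then have "p 0 1 1 > 0" "p 1 1 2 > 0" "p 2 1 3 > 0"
      unfolding b using assms by simp_all
    moreover have "h = 0 \<or> h = 1 \<or> h = 2" if "h < 3" for h :: nat
      using that by auto
    ultimately have "p h 1 (h + 1) > 0" if "h < 3" for h
      using that by (fastforce simp del: One_nat_def)
    then show "distance_regular_space (verts G) (gdist G) 3 p"
      using graph.distance_regular_space_gdist[OF G p] diam by simp
  qed
  interpret two_parameter_array "verts G" "gdist G" p "int r" "int t"
  proof -
    have "int (4*r*t - r + 2*t) = 4 * int r * int t - int r + 2 * int t" "int (4*t - 1) = 4 * int t - 1"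
      unfolding of_nat_add of_nat_diff[OF le(1)] of_nat_diff[OF le(2)] by simp_all
    then show "two_parameter_array (verts G) (gdist G) p (int r) (int t)"
      by unfold_locales (simp_all only: b c of_nat_mult, simp_all add: assms add.commute)
  qed
  show False by (rule no_such_array)
qed

end
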